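(* Assume $\gamma\le 1/2$. In the erasure model with parameter $\gamma$, any (possibly randomized) algorithm solving SELECT on $n$ elements with probability $2/3$, even one allowed $O(n/\gamma)$ comparisons per round, necessarily has round complexity $\Omega(\log^*(n))$.
   Context: Setting. The input is a set of $n$ elements with an unknown total order, presented in uniformly random order (the elements are a priori indistinguishable). SELECT (with $k=n/2$): output the median of the $n$ elements. Algorithms access the order only through pairwise comparison queries; the same pair may be queried several times (resampling). Round complexity is the number of adaptive rounds (within a round all queries are chosen before any answer of that round is seen). Erasure model with parameter $\gamma$: each comparison independently returns the correct answer with probability $\gamma$ and the symbol $\bot$ (erased) with probability $1-\gamma$. $\log^*$ is the iterated logarithm. Asymptotics are as $n\to\infty$. The success probability is over the random input order, the comparison outcomes and the algorithm's randomness. *)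

theory Defs
  imports "HOL-Probability.Probability" "HOL-Combinatorics.Permutations"
begin

text \<open>
  The input is the set of labels \<open>{..<n}\<close>; its hidden order is given by a permutation \<open>\<sigma>\<close> of
  \<open>{..<n}\<close>, where \<open>\<sigma> i\<close> is the 0-based rank of the element \<open>i\<close>.
\<close>

type_synonym query = "nat \<times> nat"

text \<open>\<open>None\<close> is the erasure symbol; \<open>Some b\<close> is the answer to the question whether \<open>i\<close> precedes \<open>j\<close>.\<close>

type_synonym answer = "bool option"

text \<open>
  A deterministic round-based algorithm for a fixed input size: it either stops with an output or
  issues a whole batch of comparisons, and continues depending on the list of answers.
  Batches are lists, so that repeating a comparison is possible and is counted with multiplicity.
  A randomized algorithm is a distribution on deterministic ones. Discrete distributions lose
  nothing: for bounded batch sizes and numbers of rounds there are, up to the behaviour on answer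
  lists of the wrong length, only countably many deterministic algorithms.
\<close>

datatype algorithm = Output nat | Round "query list" "answer list \<Rightarrow> algorithm"

definition erasure_answer :: "real \<Rightarrow> (nat \<Rightarrow> nat) \<Rightarrow> query \<Rightarrow> answer pmf" where
  "erasure_answer \<gamma> \<sigma> q =
     map_pmf (\<lambda>b. if b then Some (\<sigma> (fst q) < \<sigma> (snd q)) else None) (bernoulli_pmf \<gamma>)"

primrec erasure_answers :: "real \<Rightarrow> (nat \<Rightarrow> nat) \<Rightarrow> query list \<Rightarrow> answer list pmf" where
  "erasure_answers \<gamma> \<sigma> [] = return_pmf []"
| "erasure_answers \<gamma> \<sigma> (q # qs) =
     map_pmf (\<lambda>(a, as). a # as) (pair_pmf (erasure_answer \<gamma> \<sigma> q) (erasure_answers \<gamma> \<sigma> qs))"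

text \<open>The list of batches issued, one per round, together with the output.\<close>

primrec run ::
  "real \<Rightarrow> (nat \<Rightarrow> nat) \<Rightarrow> algorithm \<Rightarrow> (query list list \<times> nat) pmf" where
  "run \<gamma> \<sigma> (Output x) = return_pmf ([], x)"
| "run \<gamma> \<sigma> (Round qs f) =
     bind_pmf (erasure_answers \<gamma> \<sigma> qs)
       (\<lambda>as. map_pmf (\<lambda>(bs, x). (qs # bs, x)) (run \<gamma> \<sigma> (f as)))"

text \<open>The joint distribution of the input order, the batches issued and the output.\<close>

definition joint_run ::
  "nat \<Rightarrow> real \<Rightarrow> algorithm pmf \<Rightarrow> ((nat \<Rightarrow> nat) \<times> query list list \<times> nat) pmf" where
  "joint_run n \<gamma> A =
     bind_pmf (pmf_of_set {\<sigma>. \<sigma> permutes {..<n}})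
       (\<lambda>\<sigma>. bind_pmf A (\<lambda>t. map_pmf (\<lambda>(bs, x). (\<sigma>, bs, x)) (run \<gamma> \<sigma> t)))"

definition kth_smallest :: "nat \<Rightarrow> nat \<Rightarrow> (nat \<Rightarrow> nat) \<Rightarrow> nat \<Rightarrow> bool" where
  "kth_smallest n k \<sigma> x \<longleftrightarrow> x < n \<and> card {y \<in> {..<n}. \<sigma> y \<le> \<sigma> x} = k"

text \<open>For odd \<open>n\<close>, \<open>k = n / 2\<close> is rounded up, which gives the middle element.\<close>

definition is_median :: "nat \<Rightarrow> (nat \<Rightarrow> nat) \<Rightarrow> nat \<Rightarrow> bool" where
  "is_median n \<sigma> x \<longleftrightarrow> kth_smallest n ((n + 1) div 2) \<sigma> x"

definition select_success_prob :: "nat \<Rightarrow> real \<Rightarrow> algorithm pmf \<Rightarrow> real" where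
  "select_success_prob n \<gamma> A =
     measure_pmf.prob (joint_run n \<gamma> A) {(\<sigma>, bs, x). is_median n \<sigma> x}"

definition queries_elements :: "nat \<Rightarrow> real \<Rightarrow> algorithm pmf \<Rightarrow> bool" where
  "queries_elements n \<gamma> A \<longleftrightarrow>
     (\<forall>(\<sigma>, bs, x) \<in> set_pmf (joint_run n \<gamma> A). \<forall>qs \<in> set bs. \<forall>(i, j) \<in> set qs.
        i < n \<and> j < n \<and> i \<noteq> j)"

definition comparisons_per_round_le :: "nat \<Rightarrow> real \<Rightarrow> algorithm pmf \<Rightarrow> real \<Rightarrow> bool" where
  "comparisons_per_round_le n \<gamma> A B \<longleftrightarrow>
     (\<forall>(\<sigma>, bs, x) \<in> set_pmf (joint_run n \<gamma> A). \<forall>qs \<in> set bs. real (length qs) \<le> B)"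

text \<open>Worst case over all possible runs; infinite if the number of rounds is unbounded.\<close>

definition round_complexity :: "nat \<Rightarrow> real \<Rightarrow> algorithm pmf \<Rightarrow> enat" where
  "round_complexity n \<gamma> A = (SUP (\<sigma>, bs, x) \<in> set_pmf (joint_run n \<gamma> A). enat (length bs))"

definition log_star :: "real \<Rightarrow> nat" where
  "log_star x = (LEAST k. (log 2 ^^ k) x \<le> 1)"

end

theory Submission
  imports Defs "HOL-Real_Asymp.Real_Asymp"
begin

text \<open>
  Call an element untouched if all comparisons involving it were erased. If \<open>u\<close> elements are
  untouched, a batch of \<open>C n / \<gamma>\<close> comparisons leaves, by Jensen's inequality, at least
  \<open>u exp (- 4 C n / u)\<close> of them untouched in expectation. Each comparison is answered with
  probability \<open>\<gamma>\<close> and then changes this number by at most 2, so its variance is at most \<open>4 C n\<close>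
  and Chebyshev's inequality applies. Hence \<open>n / u\<close> grows at most exponentially from one round
  to the next, and with high probability untouched elements remain as long as the number of rounds
  is a small multiple of \<open>log\<^sup>* n\<close>.

  As long as \<open>v\<close> is untouched, its rank does not influence the probability of any transcript.
  Shifting the rank of the least untouched element cyclically by half of \<open>n\<close> makes every correct
  output incorrect, so the algorithm succeeds with probability at most \<open>1 / 2\<close> while some element
  is untouched.
\<close>

section \<open>Runs that record the untouched elements\<close>

text \<open>Removal looks only at whether there is an answer, not at what it says. Running out of
  answers is a dummy case, since answer lists of positive probability match the batch in
  length.\<close>

primrec remaining :: "query list \<Rightarrow> answer list \<Rightarrow> nat set \<Rightarrow> nat set" where
  "remaining [] as U = U"
| "remaining (q # qs) as U = (case as of [] \<Rightarrow> U | a # as' \<Rightarrow>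
     remaining qs as' (if a = None then U else U - {fst q, snd q}))"

text \<open>The batches are forgotten: the symmetry argument needs only the joint law of the output
  and the final untouched set.\<close>

primrec tracked_run :: "real \<Rightarrow> (nat \<Rightarrow> nat) \<Rightarrow> algorithm \<Rightarrow> nat set \<Rightarrow> (nat set \<times> nat) pmf" where
  "tracked_run \<gamma> \<sigma> (Output x) U = return_pmf (U, x)"
| "tracked_run \<gamma> \<sigma> (Round qs f) U =
     bind_pmf (erasure_answers \<gamma> \<sigma> qs) (\<lambda>as. tracked_run \<gamma> \<sigma> (f as) (remaining qs as U))"

lemma remaining_subset: "remaining qs as U \<subseteq> U"
proof (induction qs arbitrary: as U)
  case (Cons q qs)
  show ?case
  proof (cases as)
    case (Cons a as')
    then show ?thesis using Cons.IH[of as' "if a = None then U else U - {fst q, snd q}"]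
      by (auto split: if_splits)
  qed simp
qed simp

lemma tracked_run_subset:
  "(V, x) \<in> set_pmf (tracked_run \<gamma> \<sigma> t U) \<Longrightarrow> V \<subseteq> U"
proof (induction t arbitrary: U)
  case (Round qs f)
  then obtain as where "(V, x) \<in> set_pmf (tracked_run \<gamma> \<sigma> (f as) (remaining qs as U))"
    by auto
  with Round.IH[OF rangeI] remaining_subset show ?case by blast
qed simp

lemma map_snd_tracked_run: "map_pmf snd (tracked_run \<gamma> \<sigma> t U) = map_pmf snd (run \<gamma> \<sigma> t)"
proof (induction t arbitrary: U)
  case (Round qs f)
  have "map_pmf snd (map_pmf (\<lambda>(bs, x). (qs # bs, x)) p) = map_pmf snd p" for p :: "(query list list \<times> nat) pmf"
    by (simp add: map_pmf_comp case_prod_beta)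
  then show ?case using Round.IH by (simp add: map_bind_pmf)
qed simp

lemma set_pmf_erasure_answers_length:
  "as \<in> set_pmf (erasure_answers \<gamma> \<sigma> qs) \<Longrightarrow> length as = length qs"
  by (induction qs arbitrary: as) auto

lemma finite_answer_lists: "finite {as :: answer list. length as = m}"
  using finite_lists_length_eq[of "UNIV :: answer set" m] by simp

lemma finite_set_pmf_erasure_answers [simp]: "finite (set_pmf (erasure_answers \<gamma> \<sigma> qs))"
  by (rule finite_subset[OF _ finite_answer_lists[of "length qs"]])
     (auto dest: set_pmf_erasure_answers_length)

lemma pmf_erasure_answers_Nil: "pmf (erasure_answers \<gamma> \<sigma> (q # qs)) [] = 0"
  by (auto simp: pmf_eq_0_set_pmf)

lemma pmf_erasure_answers_Cons:
  "pmf (erasure_answers \<gamma> \<sigma> (q # qs)) (a # as)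
     = pmf (erasure_answer \<gamma> \<sigma> q) a * pmf (erasure_answers \<gamma> \<sigma> qs) as"
proof -
  have "inj (\<lambda>(a :: answer, as). a # as)" by (auto simp: inj_def)
  from pmf_map_inj'[OF this, of "pair_pmf (erasure_answer \<gamma> \<sigma> q) (erasure_answers \<gamma> \<sigma> qs)" "(a, as)"]
  show ?thesis by (simp add: pmf_pair)
qed

section \<open>Independence of the run from the rank of an untouched element\<close>

text \<open>Relative order is compared instead of ranks, because moving \<open>v\<close> shifts the
  ranks of the elements that it passes.\<close>

definition agree_off :: "nat \<Rightarrow> (nat \<Rightarrow> nat) \<Rightarrow> (nat \<Rightarrow> nat) \<Rightarrow> bool" where
  "agree_off v \<sigma> \<tau> \<longleftrightarrow> (\<forall>i j. i \<noteq> v \<longrightarrow> j \<noteq> v \<longrightarrow> (\<sigma> i < \<sigma> j \<longleftrightarrow> \<tau> i < \<tau> j))"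

lemma pmf_erasure_answer_None:
  "pmf (erasure_answer \<gamma> \<sigma> q) None = pmf (erasure_answer \<gamma> \<tau> q) None"
proof -
  have "(\<lambda>b. if b then Some (\<sigma> (fst q) < \<sigma> (snd q)) else None) -` {None} = {False}"
       "(\<lambda>b. if b then Some (\<tau> (fst q) < \<tau> (snd q)) else None) -` {None} = {False}"
    by (auto split: if_splits)
  then show ?thesis by (simp add: erasure_answer_def pmf_map)
qed

text \<open>If \<open>v\<close> survives, every comparison involving it was erased, which is equally
  likely under any order; all other comparisons have the same true answer under both orders.\<close>

lemma pmf_erasure_answers_agree:
  assumes "agree_off v \<sigma> \<tau>" "v \<in> remaining qs as U"
  shows "pmf (erasure_answers \<gamma> \<sigma> qs) as = pmf (erasure_answers \<gamma> \<tau> qs) as"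
  using assms(2)
proof (induction qs arbitrary: as U)
  case (Cons q qs)
  show ?case
  proof (cases as)
    case Nil
    then show ?thesis by (simp only: pmf_erasure_answers_Nil)
  next
    case as: (Cons a as')
    let ?U = "if a = None then U else U - {fst q, snd q}"
    have v: "v \<in> remaining qs as' ?U" using Cons.prems as by simp
    then have "v \<in> ?U" using remaining_subset by blast
    then have "pmf (erasure_answer \<gamma> \<sigma> q) a = pmf (erasure_answer \<gamma> \<tau> q) a"
    proof (cases "a = None")
      case True
      then show ?thesis using pmf_erasure_answer_None by simp
    next
      case False
      with \<open>v \<in> ?U\<close> have "fst q \<noteq> v" "snd q \<noteq> v" by auto
      then have "\<sigma> (fst q) < \<sigma> (snd q) \<longleftrightarrow> \<tau> (fst q) < \<tau> (snd q)"
        using assms(1) by (simp add: agree_off_def)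
      then have "erasure_answer \<gamma> \<sigma> q = erasure_answer \<gamma> \<tau> q"
        unfolding erasure_answer_def by (intro map_pmf_cong) auto
      then show ?thesis by simp
    qed
    with Cons.IH[OF v] show ?thesis by (simp only: as pmf_erasure_answers_Cons)
  qed
qed simp

text \<open>Condition on the answers of the first round: lists after which \<open>v\<close> is not
  among the survivors contribute 0 under both orders, since no element ever returns; the other lists
  are equally likely.\<close>

lemma pmf_tracked_run_agree:
  assumes "agree_off v \<sigma> \<tau>" "v \<in> V"
  shows "pmf (tracked_run \<gamma> \<sigma> t U) (V, x) = pmf (tracked_run \<gamma> \<tau> t U) (V, x)"
proof (induction t arbitrary: U)
  case (Round qs f)
  let ?L = "{as :: answer list. length as = length qs}"
  have *: "pmf (tracked_run \<gamma> \<rho> (Round qs f) U) (V, x) =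
      (\<Sum>as\<in>?L. pmf (tracked_run \<gamma> \<rho> (f as) (remaining qs as U)) (V, x)
                  * pmf (erasure_answers \<gamma> \<rho> qs) as)" for \<rho>
    unfolding tracked_run.simps pmf_bind
    by (rule integral_measure_pmf_real[OF finite_answer_lists])
       (auto dest: set_pmf_erasure_answers_length)
  show ?case unfolding *
  proof (rule sum.cong[OF refl])
    fix as
    show "pmf (tracked_run \<gamma> \<sigma> (f as) (remaining qs as U)) (V, x) * pmf (erasure_answers \<gamma> \<sigma> qs) as
      = pmf (tracked_run \<gamma> \<tau> (f as) (remaining qs as U)) (V, x) * pmf (erasure_answers \<gamma> \<tau> qs) as"
    proof (cases "v \<in> remaining qs as U")
      case True
      then show ?thesis
        using Round.IH[OF rangeI] pmf_erasure_answers_agree[OF assms(1) True] by simp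
    next
      case False
      then have "pmf (tracked_run \<gamma> \<rho> (f as) (remaining qs as U)) (V, x) = 0" for \<rho>
        using tracked_run_subset assms(2) unfolding pmf_eq_0_set_pmf by blast
      then show ?thesis by simp
    qed
  qed
qed simp

lemma prob_tracked_run_agree:
  assumes "agree_off v \<sigma> \<tau>" "\<And>V x. (V, x) \<in> E \<Longrightarrow> v \<in> V"
  shows "measure_pmf.prob (tracked_run \<gamma> \<sigma> t U) E = measure_pmf.prob (tracked_run \<gamma> \<tau> t U) E"
  unfolding measure_pmf_conv_infsetsum
  by (rule infsetsum_cong) (use pmf_tracked_run_agree[OF assms(1)] assms(2) in auto)

section \<open>Cyclic shift of one rank\<close>

text \<open>The element of rank \<open>p\<close> is taken out, the gap is closed, and it is put back
  at rank \<open>p'\<close>; the others keep their relative order.\<close>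

definition move_rank :: "nat \<Rightarrow> nat \<Rightarrow> nat \<Rightarrow> nat" where
  "move_rank p p' r = (if r = p then p' else
     let r' = (if r < p then r else r - 1) in if r' < p' then r' else r' + 1)"

lemma move_rank_less_iff: "r \<noteq> p \<Longrightarrow> s \<noteq> p \<Longrightarrow> move_rank p p' r < move_rank p p' s \<longleftrightarrow> r < s"
  by (auto simp: move_rank_def Let_def)

lemma move_rank_self [simp]: "move_rank p p' p = p'"
  by (simp add: move_rank_def)

lemma inj_move_rank: "inj (move_rank p p')"
  by (auto simp: inj_def move_rank_def Let_def split: if_splits)

lemma move_rank_permutes:
  assumes "p < n" "p' < n"
  shows "move_rank p p' permutes {..<n}"
proof (rule bij_imp_permutes)
  have "move_rank p p' ` {..<n} \<subseteq> {..<n}" using assms by (auto simp: move_rank_def Let_def)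
  then show "bij_betw (move_rank p p') {..<n} {..<n}"
    by (simp add: bij_betw_def inj_on_subset[OF inj_move_rank] endo_inj_surj)
  show "\<And>x. x \<notin> {..<n} \<Longrightarrow> move_rank p p' x = x" using assms
    by (auto simp: move_rank_def Let_def)
qed

definition shift_rank :: "nat \<Rightarrow> nat \<Rightarrow> (nat \<Rightarrow> nat) \<Rightarrow> (nat \<Rightarrow> nat)" where
  "shift_rank n v \<sigma> = move_rank (\<sigma> v) ((\<sigma> v + (n + 1) div 2) mod n) \<circ> \<sigma>"

lemma shift_rank_permutes:
  assumes "\<sigma> permutes {..<n}" "v < n"
  shows "shift_rank n v \<sigma> permutes {..<n}"
proof -
  have "\<sigma> v < n" using permutes_in_image[OF assms(1), of v] assms(2) by simp
  then show ?thesis unfolding shift_rank_def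
    by (intro permutes_compose[OF assms(1)] move_rank_permutes) auto
qed

text \<open>The old rank of \<open>v\<close> can be recovered from the new one, since adding a
  constant modulo \<open>n\<close> is injective below \<open>n\<close>; what is left is to undo one
  injective \<open>move_rank\<close>.\<close>

lemma bij_betw_shift_rank:
  assumes "v < n"
  shows "bij_betw (shift_rank n v) {\<sigma>. \<sigma> permutes {..<n}} {\<sigma>. \<sigma> permutes {..<n}}"
proof -
  let ?P = "{\<sigma>. \<sigma> permutes {..<n}}"
  have "inj_on (shift_rank n v) ?P"
  proof (rule inj_onI)
    fix \<sigma> \<tau> assume \<sigma>: "\<sigma> \<in> ?P" and \<tau>: "\<tau> \<in> ?P" and eq: "shift_rank n v \<sigma> = shift_rank n v \<tau>"
    have lt: "\<sigma> v < n" "\<tau> v < n" using \<sigma> \<tau> assms permutes_in_image[of _ "{..<n}" v] by auto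
    have "(\<sigma> v + (n + 1) div 2) mod n = (\<tau> v + (n + 1) div 2) mod n"
      using fun_cong[OF eq, of v] by (simp add: shift_rank_def)
    \<comment> \<open>For \<open>n = 1\<close> the offset equals \<open>n\<close>; for larger
      \<open>n\<close> it is below \<open>n\<close>, so reduction modulo \<open>n\<close> subtracts
      \<open>n\<close> at most once.\<close>
    then have "\<sigma> v = \<tau> v" using lt
      by (cases "n = 1") (auto simp: mod_if split: if_splits)
    then show "\<sigma> = \<tau>" using eq inj_move_rank
      by (simp add: shift_rank_def fun_eq_iff inj_eq)
  qed
  moreover have "shift_rank n v ` ?P \<subseteq> ?P" using shift_rank_permutes assms by auto
  ultimately show ?thesis
    by (simp add: bij_betw_def endo_inj_surj finite_permutations)
qed

lemma agree_off_shift_rank: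
  assumes "\<sigma> permutes {..<n}"
  shows "agree_off v \<sigma> (shift_rank n v \<sigma>)"
proof -
  have "\<sigma> i \<noteq> \<sigma> v" if "i \<noteq> v" for i using permutes_inj[OF assms] that by (auto dest: injD)
  then show ?thesis by (simp add: agree_off_def shift_rank_def move_rank_less_iff)
qed

lemma is_median_iff_rank:
  assumes "\<sigma> permutes {..<n}" "n \<ge> 1"
  shows "is_median n \<sigma> x \<longleftrightarrow> x < n \<and> \<sigma> x + 1 = (n + 1) div 2"
proof (cases "x < n")
  case True
  then have "\<sigma> x < n" using permutes_in_image[OF assms(1), of x] by simp
  have "{..\<sigma> x} = \<sigma> ` {y \<in> {..<n}. \<sigma> y \<le> \<sigma> x}"
  proof (intro equalityI subsetI)
    fix r assume "r \<in> {..\<sigma> x}"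
    then have "r \<in> \<sigma> ` {..<n}" using permutes_image[OF assms(1)] \<open>\<sigma> x < n\<close> by auto
    then show "r \<in> \<sigma> ` {y \<in> {..<n}. \<sigma> y \<le> \<sigma> x}" using \<open>r \<in> {..\<sigma> x}\<close> by auto
  qed auto
  moreover have "inj_on \<sigma> {y \<in> {..<n}. \<sigma> y \<le> \<sigma> x}"
    using permutes_inj[OF assms(1)] inj_on_subset by blast
  ultimately have "card {y \<in> {..<n}. \<sigma> y \<le> \<sigma> x} = \<sigma> x + 1"
    by (metis card_image card_atMost Suc_eq_plus1)
  then show ?thesis using True by (simp add: is_median_def kth_smallest_def)
qed (simp add: is_median_def kth_smallest_def)

text \<open>If \<open>x = v\<close>, its own rank changes. Otherwise \<open>v\<close> is moved past
  \<open>x\<close>: from below the median rank it lands above without wrapping around, and from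
  above it wraps around to the median rank or lower. Either way the rank of \<open>x\<close> changes
  by one.\<close>

lemma shift_rank_not_median:
  assumes "\<sigma> permutes {..<n}" "n \<ge> 2" "v < n" "is_median n \<sigma> x"
  shows "\<not> is_median n (shift_rank n v \<sigma>) x"
proof -
  have p: "\<sigma> v < n" using permutes_in_image[OF assms(1), of v] assms(3) by simp
  have x: "\<sigma> x + 1 = (n + 1) div 2" using assms is_median_iff_rank by simp
  have m: "(\<sigma> v + (n + 1) div 2) mod n =
     (if \<sigma> v + (n + 1) div 2 < n then \<sigma> v + (n + 1) div 2 else \<sigma> v + (n + 1) div 2 - n)"
    using p assms(2) by (auto simp: mod_if)
  have "shift_rank n v \<sigma> x + 1 \<noteq> (n + 1) div 2"
    unfolding shift_rank_def o_def move_rank_def Let_def m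
    using p x assms(2) by (auto split: if_splits; presburger)
  then show ?thesis using is_median_iff_rank[OF shift_rank_permutes[OF assms(1,3)]] assms(2) by simp
qed


section \<open>Success probability in terms of untouched elements\<close>

lemma prob_bind_pmf:
  "measure_pmf.prob (bind_pmf M f) X = measure_pmf.expectation M (\<lambda>x. measure_pmf.prob (f x) X)"
  unfolding measure_pmf_bind
  using measurable_measure_pmf[of f]
  by (subst measure_pmf.measure_bind[where N = "count_space UNIV"]) auto

text \<open>The bijection depends on \<open>v\<close>, so the sums are exchanged first and the inner
  one is reindexed for each \<open>v\<close> separately.\<close>

lemma sum_sum_le_reindex:
  fixes good bad :: "nat \<Rightarrow> 'a \<Rightarrow> real"
  assumes "\<And>v. v \<in> I \<Longrightarrow> bij_betw (F v) P P"
    and "\<And>v \<sigma>. v \<in> I \<Longrightarrow> \<sigma> \<in> P \<Longrightarrow> good v \<sigma> \<le> bad v (F v \<sigma>)"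
  shows "(\<Sum>\<sigma>\<in>P. \<Sum>v\<in>I. good v \<sigma>) \<le> (\<Sum>\<sigma>\<in>P. \<Sum>v\<in>I. bad v \<sigma>)"
proof -
  have "(\<Sum>\<sigma>\<in>P. good v \<sigma>) \<le> (\<Sum>\<sigma>\<in>P. bad v \<sigma>)" if "v \<in> I" for v
  proof -
    have "(\<Sum>\<sigma>\<in>P. good v \<sigma>) \<le> (\<Sum>\<sigma>\<in>P. bad v (F v \<sigma>))"
      using assms(2) that by (intro sum_mono)
    also have "\<dots> = (\<Sum>\<sigma>\<in>P. bad v \<sigma>)"
      by (rule sum.reindex_bij_betw[OF assms(1)[OF that]])
    finally show ?thesis .
  qed
  then have "(\<Sum>v\<in>I. \<Sum>\<sigma>\<in>P. good v \<sigma>) \<le> (\<Sum>v\<in>I. \<Sum>\<sigma>\<in>P. bad v \<sigma>)" by (rule sum_mono)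
  then show ?thesis by (simp only: sum.swap[of _ I P])
qed

text \<open>Summed over all orders, success with untouched elements left is at most as likely as
  failure with untouched elements left; runs that leave none cost at most \<epsilon>.\<close>

lemma sum_success_le:
  assumes "n \<ge> 2"
    and iso: "\<And>\<sigma>. \<sigma> permutes {..<n} \<Longrightarrow>
      measure_pmf.prob (tracked_run \<gamma> \<sigma> t {..<n}) {(V, x). V = {}} \<le> \<epsilon>"
  shows "(\<Sum>\<sigma> | \<sigma> permutes {..<n}. measure_pmf.prob (map_pmf snd (run \<gamma> \<sigma> t)) {x. is_median n \<sigma> x})
     \<le> card {\<sigma>. \<sigma> permutes {..<n}} * ((1 + \<epsilon>) / 2)"
proof -
  let ?P = "{\<sigma>. \<sigma> permutes {..<n}}"
  let ?p = "\<lambda>\<sigma>. measure_pmf.prob (tracked_run \<gamma> \<sigma> t {..<n})"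
  \<comment> \<open>Taking the minimum singles out one untouched element, so these events are
    disjoint for different \<open>v\<close>; finiteness makes \<open>Min V\<close> a member of
    \<open>V\<close>.\<close>
  define E where "E v Q = {(V, x). V \<noteq> {} \<and> finite V \<and> Min V = v \<and> Q x}" for v :: nat and Q :: "nat \<Rightarrow> bool"
  have E_mem: "v \<in> V" if "(V, x) \<in> E v Q" for v V x Q
    using that Min_in by (auto simp: E_def)
  have E_sum: "(\<Sum>v\<in>{..<n}. ?p \<sigma> (E v Q)) = ?p \<sigma> {(V, x). V \<noteq> {} \<and> Q x}" for \<sigma> Q
  proof -
    have "(\<Sum>v\<in>{..<n}. ?p \<sigma> (E v Q)) = ?p \<sigma> (\<Union>v\<in>{..<n}. E v Q)"
      by (rule measure_pmf.finite_measure_finite_Union[symmetric])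
         (auto simp: disjoint_family_on_def E_def)
    also have "\<dots> = ?p \<sigma> {(V, x). V \<noteq> {} \<and> Q x}"
    \<comment> \<open>The two events differ only on sets \<open>V\<close> not contained in
      \<open>{..<n}\<close>; these have probability 0 because runs only remove elements.\<close>
    proof (rule measure_prob_cong_0)
      fix y assume y: "y \<in> {(V, x). V \<noteq> {} \<and> Q x} - (\<Union>v\<in>{..<n}. E v Q)"
      obtain V x where [simp]: "y = (V, x)" by fastforce
      have "\<not> V \<subseteq> {..<n}"
      proof
        assume V: "V \<subseteq> {..<n}"
        then have "finite V" by (rule finite_subset) simp
        moreover from this have "Min V \<in> {..<n}" using V y Min_in by auto
        ultimately show False using y by (auto simp: E_def)
      qed
      then show "pmf (tracked_run \<gamma> \<sigma> t {..<n}) y = 0"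
        using tracked_run_subset unfolding pmf_eq_0_set_pmf \<open>y = (V, x)\<close> by blast
    qed (auto simp: E_def)
    finally show ?thesis .
  qed
  let ?g = "\<lambda>\<sigma>. ?p \<sigma> {(V, x). V \<noteq> {} \<and> is_median n \<sigma> x}"
  let ?b = "\<lambda>\<sigma>. ?p \<sigma> {(V, x). V \<noteq> {} \<and> \<not> is_median n \<sigma> x}"
  let ?e = "\<lambda>\<sigma>. ?p \<sigma> {(V, x). V = {}}"
  have gb: "(\<Sum>\<sigma>\<in>?P. ?g \<sigma>) \<le> (\<Sum>\<sigma>\<in>?P. ?b \<sigma>)"
    unfolding E_sum[symmetric]
  proof (rule sum_sum_le_reindex)
    show "bij_betw (shift_rank n v) ?P ?P" if "v \<in> {..<n}" for v
      using that bij_betw_shift_rank by simp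
    fix v \<sigma> assume v: "v \<in> {..<n}" and \<sigma>: "\<sigma> \<in> ?P"
    let ?\<tau> = "shift_rank n v \<sigma>"
    have "?p \<sigma> (E v (is_median n \<sigma>)) = ?p ?\<tau> (E v (is_median n \<sigma>))"
      using \<sigma> E_mem by (intro prob_tracked_run_agree[OF agree_off_shift_rank]) auto
    also have "\<dots> \<le> ?p ?\<tau> (E v (\<lambda>x. \<not> is_median n ?\<tau> x))"
      using shift_rank_not_median \<sigma> v assms(1)
      by (intro measure_pmf.finite_measure_mono) (auto simp: E_def)
    finally show "?p \<sigma> (E v (is_median n \<sigma>)) \<le> ?p ?\<tau> (E v (\<lambda>x. \<not> is_median n ?\<tau> x))" .
  qed
  have total: "?g \<sigma> + ?b \<sigma> + ?e \<sigma> = 1" for \<sigma>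
  proof -
    have "?g \<sigma> + ?b \<sigma> = ?p \<sigma> ({(V, x). V \<noteq> {} \<and> is_median n \<sigma> x} \<union> {(V, x). V \<noteq> {} \<and> \<not> is_median n \<sigma> x})"
      by (rule measure_pmf.finite_measure_Union[symmetric]) auto
    also have "\<dots> + ?e \<sigma> = ?p \<sigma> (({(V, x). V \<noteq> {} \<and> is_median n \<sigma> x} \<union>
        {(V, x). V \<noteq> {} \<and> \<not> is_median n \<sigma> x}) \<union> {(V, x). V = {}})"
      by (rule measure_pmf.finite_measure_Union[symmetric]) auto
    also have "\<dots> = ?p \<sigma> UNIV" by (rule arg_cong[where f = "?p \<sigma>"]) auto
    finally show ?thesis by simp
  qed
  have succ: "measure_pmf.prob (map_pmf snd (run \<gamma> \<sigma> t)) {x. is_median n \<sigma> x} \<le> ?g \<sigma> + ?e \<sigma>" for \<sigma>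
  proof -
    have "measure_pmf.prob (map_pmf snd (run \<gamma> \<sigma> t)) {x. is_median n \<sigma> x}
        = measure_pmf.prob (map_pmf snd (tracked_run \<gamma> \<sigma> t {..<n})) {x. is_median n \<sigma> x}"
      by (simp only: map_snd_tracked_run)
    also have "\<dots> = ?p \<sigma> (snd -` {x. is_median n \<sigma> x})" by (rule measure_map_pmf)
    also have "\<dots> \<le> ?p \<sigma> ({(V, x). V \<noteq> {} \<and> is_median n \<sigma> x} \<union> {(V, x). V = {}})"
      by (rule measure_pmf.finite_measure_mono) auto
    also have "\<dots> \<le> ?g \<sigma> + ?e \<sigma>" by (rule measure_Un_le) auto
    finally show ?thesis .
  qed
  \<comment> \<open>One of the two copies of \<open>?g\<close> is replaced by \<open>?b\<close>,
    which completes a total probability of 1.\<close>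
  have "2 * (\<Sum>\<sigma>\<in>?P. ?g \<sigma> + ?e \<sigma>) \<le> (\<Sum>\<sigma>\<in>?P. ?g \<sigma> + ?b \<sigma> + ?e \<sigma>) + (\<Sum>\<sigma>\<in>?P. ?e \<sigma>)"
    using gb by (simp add: sum.distrib)
  also have "\<dots> \<le> (\<Sum>\<sigma>\<in>?P. 1) + (\<Sum>\<sigma>\<in>?P. \<epsilon>)"
    unfolding total by (intro add_mono sum_mono iso) auto
  finally have "2 * (\<Sum>\<sigma>\<in>?P. ?g \<sigma> + ?e \<sigma>) \<le> card ?P * (1 + \<epsilon>)"
    by (simp add: algebra_simps)
  then have "(\<Sum>\<sigma>\<in>?P. ?g \<sigma> + ?e \<sigma>) \<le> card ?P * ((1 + \<epsilon>) / 2)" by simp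
  moreover have "(\<Sum>\<sigma>\<in>?P. measure_pmf.prob (map_pmf snd (run \<gamma> \<sigma> t)) {x. is_median n \<sigma> x})
      \<le> (\<Sum>\<sigma>\<in>?P. ?g \<sigma> + ?e \<sigma>)"
    by (intro sum_mono succ)
  ultimately show ?thesis by linarith
qed

section \<open>Mean and variance of the number of survivors of one batch\<close>

text \<open>Conditions on whether the first comparison is erased. The assumption on \<open>g\<close>
  says that the content of its answer does not matter, as is the case for
  \<open>remaining\<close>.\<close>

lemma expectation_erasure_answers_Cons:
  fixes g :: "answer list \<Rightarrow> real"
  assumes "0 < \<gamma>" "\<gamma> \<le> 1" and g: "\<And>b as. g (Some b # as) = h as"
  shows "measure_pmf.expectation (erasure_answers \<gamma> \<sigma> (q # qs)) g =
    (1 - \<gamma>) * measure_pmf.expectation (erasure_answers \<gamma> \<sigma> qs) (\<lambda>as. g (None # as))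
    + \<gamma> * measure_pmf.expectation (erasure_answers \<gamma> \<sigma> qs) h"
proof -
  let ?a = "\<lambda>b. if b then Some (\<sigma> (fst q) < \<sigma> (snd q)) else None"
  have "erasure_answers \<gamma> \<sigma> (q # qs) =
      bind_pmf (bernoulli_pmf \<gamma>) (\<lambda>b. map_pmf ((#) (?a b)) (erasure_answers \<gamma> \<sigma> qs))"
    by (simp add: erasure_answer_def pair_pmf_def map_pmf_def bind_assoc_pmf bind_return_pmf)
  then have "measure_pmf.expectation (erasure_answers \<gamma> \<sigma> (q # qs)) g = (\<Sum>b\<in>UNIV. pmf (bernoulli_pmf \<gamma>) b *\<^sub>R
      measure_pmf.expectation (map_pmf ((#) (?a b)) (erasure_answers \<gamma> \<sigma> qs)) g)"
    by (simp only: pmf_expectation_bind[of UNIV] finite set_map_pmf finite_imageI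
        finite_set_pmf_erasure_answers subset_UNIV)
  then show ?thesis using assms by (simp add: UNIV_bool)
qed

definition degree_in :: "query list \<Rightarrow> nat \<Rightarrow> nat" where
  "degree_in qs v = length (filter (\<lambda>q. v \<in> {fst q, snd q}) qs)"

lemma sum_degree_in_le:
  assumes "finite U"
  shows "(\<Sum>v\<in>U. degree_in qs v) \<le> 2 * length qs"
proof (induction qs)
  case (Cons q qs)
  have "degree_in (q # qs) v = degree_in qs v + (if v \<in> {fst q, snd q} then 1 else 0)" for v
    by (simp add: degree_in_def)
  then have "(\<Sum>v\<in>U. degree_in (q # qs) v) = (\<Sum>v\<in>U. degree_in qs v) + card (U \<inter> {fst q, snd q})"
    using assms by (simp add: sum.distrib sum.If_cases Int_def)
  moreover have "card (U \<inter> {fst q, snd q}) \<le> card {fst q, snd q}" by (rule card_mono) auto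
  moreover have "card {fst q, snd q} \<le> 2" by (simp add: card_insert_if)
  ultimately show ?case using Cons.IH by simp
qed (simp add: degree_in_def)

text \<open>The expected number of survivors, by linearity: \<open>v\<close> survives exactly when
  all comparisons involving it are erased.\<close>

definition mean_remaining :: "real \<Rightarrow> query list \<Rightarrow> nat set \<Rightarrow> real" where
  "mean_remaining \<gamma> qs U = (\<Sum>v\<in>U. (1 - \<gamma>) ^ degree_in qs v)"

text \<open>An answer to the first comparison removes at most two elements, each of weight between 0
  and 1; this jump of at most 2 drives the variance bound.\<close>

lemma mean_remaining_Cons:
  assumes "finite U" "0 < \<gamma>" "\<gamma> \<le> 1"
  shows "mean_remaining \<gamma> (q # qs) U =
           (1 - \<gamma>) * mean_remaining \<gamma> qs U + \<gamma> * mean_remaining \<gamma> qs (U - {fst q, snd q})"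
    and "0 \<le> mean_remaining \<gamma> qs U - mean_remaining \<gamma> qs (U - {fst q, snd q})"
    and "mean_remaining \<gamma> qs U - mean_remaining \<gamma> qs (U - {fst q, snd q}) \<le> 2"
proof -
  let ?I = "U \<inter> {fst q, snd q}" and ?D = "U - {fst q, snd q}"
  have split: "(\<Sum>v\<in>U. f v) = (\<Sum>v\<in>?I. f v) + (\<Sum>v\<in>?D. f v)" for f :: "nat \<Rightarrow> real"
    using assms(1) by (metis add.commute sum.Int_Diff)
  have "(\<Sum>v\<in>?I. (1 - \<gamma>) ^ degree_in (q # qs) v) = (1 - \<gamma>) * (\<Sum>v\<in>?I. (1 - \<gamma>) ^ degree_in qs v)"
    unfolding sum_distrib_left by (rule sum.cong) (auto simp: degree_in_def)
  moreover have "(\<Sum>v\<in>?D. (1 - \<gamma>) ^ degree_in (q # qs) v) = (\<Sum>v\<in>?D. (1 - \<gamma>) ^ degree_in qs v)"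
    by (rule sum.cong) (auto simp: degree_in_def)
  ultimately show "mean_remaining \<gamma> (q # qs) U =
           (1 - \<gamma>) * mean_remaining \<gamma> qs U + \<gamma> * mean_remaining \<gamma> qs ?D"
    unfolding mean_remaining_def split[of "\<lambda>v. (1 - \<gamma>) ^ degree_in (q # qs) v"]
      split[of "\<lambda>v. (1 - \<gamma>) ^ degree_in qs v"]
    by (simp add: algebra_simps)
  have d: "mean_remaining \<gamma> qs U - mean_remaining \<gamma> qs ?D = (\<Sum>v\<in>?I. (1 - \<gamma>) ^ degree_in qs v)"
    unfolding mean_remaining_def split[of "\<lambda>v. (1 - \<gamma>) ^ degree_in qs v"] by simp
  show "0 \<le> mean_remaining \<gamma> qs U - mean_remaining \<gamma> qs ?D"
    unfolding d using assms by (intro sum_nonneg) auto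
  have "(\<Sum>v\<in>?I. (1 - \<gamma>) ^ degree_in qs v) \<le> (\<Sum>v\<in>?I. 1)"
    using assms by (intro sum_mono power_le_one) auto
  also have "\<dots> = card ?I" by simp
  also have "card ?I \<le> card {fst q, snd q}" by (rule card_mono) auto
  also have "card {fst q, snd q} \<le> 2" by (simp add: card_insert_if)
  finally show "mean_remaining \<gamma> qs U - mean_remaining \<gamma> qs ?D \<le> 2" unfolding d by simp
qed

lemma expectation_remaining:
  assumes "finite U" "0 < \<gamma>" "\<gamma> \<le> 1"
  shows "measure_pmf.expectation (erasure_answers \<gamma> \<sigma> qs) (\<lambda>as. real (card (remaining qs as U)))
    = mean_remaining \<gamma> qs U"
  using assms(1)
proof (induction qs arbitrary: U)
  case (Cons q qs)
  show ?case
    by (subst expectation_erasure_answers_Cons[where h = "\<lambda>as. real (card (remaining qs as (U - {fst q, snd q})))"])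
       (use assms Cons in \<open>simp_all add: mean_remaining_Cons(1)\<close>)
qed (simp add: mean_remaining_def degree_in_def)

text \<open>
  By the law of total variance for the first comparison, each comparison contributes at most
  \<open>\<gamma> (1 - \<gamma>) 2\<^sup>2\<close>.
\<close>

lemma variance_remaining:
  assumes "finite U" "0 < \<gamma>" "\<gamma> \<le> 1"
  shows "measure_pmf.expectation (erasure_answers \<gamma> \<sigma> qs)
      (\<lambda>as. (real (card (remaining qs as U)) - mean_remaining \<gamma> qs U)\<^sup>2) \<le> 4 * \<gamma> * length qs"
  using assms(1)
proof (induction qs arbitrary: U)
  case (Cons q qs)
  let ?E = "measure_pmf.expectation (erasure_answers \<gamma> \<sigma> qs)"
  let ?D = "U - {fst q, snd q}" and ?m = "mean_remaining \<gamma> qs"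
  define M where "M = mean_remaining \<gamma> (q # qs) U"
  have int: "integrable (measure_pmf (erasure_answers \<gamma> \<sigma> qs)) f" for f :: "answer list \<Rightarrow> real"
    by (rule integrable_measure_pmf_finite) simp
  \<comment> \<open>The second moment about \<open>c\<close> is the variance plus the squared
    distance of \<open>c\<close> from the mean.\<close>
  have shift: "?E (\<lambda>as. (real (card (remaining qs as W)) - c)\<^sup>2) \<le> 4 * \<gamma> * length qs + (?m W - c)\<^sup>2"
    if "finite W" for W c
  proof -
    have "(\<lambda>as. (real (card (remaining qs as W)) - c)\<^sup>2) = (\<lambda>as. (real (card (remaining qs as W)) - ?m W)\<^sup>2
        + 2 * (?m W - c) * real (card (remaining qs as W)) + (c\<^sup>2 - (?m W)\<^sup>2))"
      by (rule ext) (simp add: power2_eq_square algebra_simps)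
    then have "?E (\<lambda>as. (real (card (remaining qs as W)) - c)\<^sup>2)
        = ?E (\<lambda>as. (real (card (remaining qs as W)) - ?m W)\<^sup>2) + 2 * (?m W - c) * ?m W + (c\<^sup>2 - (?m W)\<^sup>2)"
      using expectation_remaining[OF that assms(2,3)]
      by (simp add: Bochner_Integration.integral_add[OF int int] del: Bochner_Integration.integral_add)
    also have "\<dots> = ?E (\<lambda>as. (real (card (remaining qs as W)) - ?m W)\<^sup>2) + (?m W - c)\<^sup>2"
      by (simp add: power2_eq_square algebra_simps)
    finally show ?thesis using Cons.IH[OF that] by simp
  qed
  have M: "M = (1 - \<gamma>) * ?m U + \<gamma> * ?m ?D"
    unfolding M_def using mean_remaining_Cons(1)[OF Cons.prems assms(2,3)] .
  have "measure_pmf.expectation (erasure_answers \<gamma> \<sigma> (q # qs))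
      (\<lambda>as. (real (card (remaining (q # qs) as U)) - M)\<^sup>2)
    = (1 - \<gamma>) * ?E (\<lambda>as. (real (card (remaining qs as U)) - M)\<^sup>2)
      + \<gamma> * ?E (\<lambda>as. (real (card (remaining qs as ?D)) - M)\<^sup>2)"
    by (subst expectation_erasure_answers_Cons[where h = "\<lambda>as. (real (card (remaining qs as ?D)) - M)\<^sup>2"])
       (use assms in simp_all)
  also have "\<dots> \<le> (1 - \<gamma>) * (4 * \<gamma> * length qs + (?m U - M)\<^sup>2) + \<gamma> * (4 * \<gamma> * length qs + (?m ?D - M)\<^sup>2)"
    using assms Cons.prems by (intro add_mono mult_left_mono shift) auto
  also have "\<dots> = 4 * \<gamma> * length qs + \<gamma> * ((1 - \<gamma>) * (?m U - ?m ?D)\<^sup>2)"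
    unfolding M by (simp add: power2_eq_square algebra_simps)
  also have "\<dots> \<le> 4 * \<gamma> * length qs + \<gamma> * (1 * 2\<^sup>2)"
    using assms mean_remaining_Cons(2,3)[OF Cons.prems assms(2,3), of qs q]
    by (intro add_left_mono mult_left_mono mult_mono power_mono) auto
  also have "\<dots> = 4 * \<gamma> * length (q # qs)" by (simp add: algebra_simps)
  finally show ?case unfolding M_def .
qed (simp add: mean_remaining_def degree_in_def)

text \<open>Every comparison has at most two endpoints in \<open>U\<close>, so
  \<open>2 * \<gamma> * degree_in qs v\<close> averages at most \<open>a\<close> over
  \<open>U\<close>. As \<open>\<gamma> \<le> 1 / 2\<close> gives
  \<open>exp (- (2 * \<gamma>)) \<le> 1 - \<gamma>\<close>, convexity of \<open>exp\<close> yields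
  the bound.\<close>

lemma mean_remaining_ge:
  fixes \<gamma> a :: real
  assumes "finite U" "0 < \<gamma>" "\<gamma> \<le> 1 / 2" and a: "4 * \<gamma> * length qs \<le> a * card U"
  shows "card U * exp (- a) \<le> mean_remaining \<gamma> qs U"
proof -
  have "exp (- (2 * \<gamma>)) \<le> 1 - \<gamma>"
  proof -
    have "1 \<le> (1 - \<gamma>) * (1 + 2 * \<gamma>)"
      using mult_nonneg_nonneg[of \<gamma> "1 - 2 * \<gamma>"] assms by (simp add: algebra_simps)
    also have "\<dots> \<le> (1 - \<gamma>) * exp (2 * \<gamma>)" using assms by (intro mult_left_mono exp_ge_add_one_self) auto
    finally show ?thesis by (simp add: exp_minus field_simps)
  qed
  then have pw: "exp (- (2 * \<gamma> * d)) \<le> (1 - \<gamma>) ^ d" for d :: nat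
    using power_mono[of "exp (- (2 * \<gamma>))" "1 - \<gamma>" d] by (simp add: exp_of_nat_mult[symmetric] mult_ac)
  \<comment> \<open>Jensen's inequality, via the tangent of \<open>exp\<close> at \<open>- a\<close>\<close>
  have tangent: "exp (- a) * (1 + a - y) \<le> exp (- y)" for y :: real
  proof -
    have "exp (- a) * (1 + (a - y)) \<le> exp (- a) * exp (a - y)"
      by (intro mult_left_mono exp_ge_add_one_self) auto
    then show ?thesis by (simp add: exp_add[symmetric] algebra_simps)
  qed
  have "(\<Sum>v\<in>U. 2 * \<gamma> * degree_in qs v) = 2 * \<gamma> * real (\<Sum>v\<in>U. degree_in qs v)"
    by (simp add: sum_distrib_left)
  also have "\<dots> \<le> 2 * \<gamma> * real (2 * length qs)"
    using sum_degree_in_le[OF assms(1), of qs] assms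
    by (intro mult_left_mono) (auto simp flip: of_nat_le_iff simp del: of_nat_sum)
  finally have deg: "(\<Sum>v\<in>U. 2 * \<gamma> * degree_in qs v) \<le> a * card U" using a by simp
  have "card U * exp (- a) \<le> exp (- a) * (card U + (a * card U - (\<Sum>v\<in>U. 2 * \<gamma> * degree_in qs v)))"
    using deg by (simp add: algebra_simps)
  also have "\<dots> = (\<Sum>v\<in>U. exp (- a) * (1 + a - 2 * \<gamma> * degree_in qs v))"
    by (simp add: sum_distrib_left[symmetric] sum.distrib sum_subtractf algebra_simps)
  also have "\<dots> \<le> mean_remaining \<gamma> qs U"
    unfolding mean_remaining_def using order_trans[OF tangent pw] by (intro sum_mono) auto
  finally show ?thesis .
qed

text \<open>Chebyshev's inequality: the mean is at least twice the threshold. In the exponent,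
  \<open>4 * C * R\<close> comes from the bound on the mean; the extra \<open>R\<close> pays for
  this factor 2 and for starting with only \<open>n / R\<close> elements.\<close>

lemma prob_remaining_small:
  assumes U: "finite U" "real (card U) \<ge> n / R" and \<gamma>: "0 < \<gamma>" "\<gamma> \<le> 1 / 2"
    and C: "C > 0" and n: "n > 0" and R: "R \<ge> 1" and len: "real (length qs) \<le> C * (n / \<gamma>)"
  shows "measure_pmf.prob (erasure_answers \<gamma> \<sigma> qs)
     {as. real (card (remaining qs as U)) < n / exp ((4 * C + 1) * R)}
       \<le> 4 * C * (exp ((4 * C + 1) * R))\<^sup>2 / n"
proof -
  let ?p = "erasure_answers \<gamma> \<sigma> qs"
  let ?N = "\<lambda>as. real (card (remaining qs as U))"
  let ?M = "mean_remaining \<gamma> qs U"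
  define a where "a = n / exp ((4 * C + 1) * R)"
  have a: "a > 0" using n by (simp add: a_def)
  have len': "\<gamma> * length qs \<le> C * n" using len \<gamma> by (simp add: field_simps)
  have "4 * \<gamma> * length qs \<le> 4 * C * n" using len' by simp
  also have "\<dots> = (4 * C * R) * (n / R)" using R by simp
  also have "\<dots> \<le> (4 * C * R) * card U" using U(2) C R by (intro mult_left_mono) auto
  finally have "card U * exp (- (4 * C * R)) \<le> ?M"
    by (rule mean_remaining_ge[OF U(1) \<gamma>])
  moreover have "2 * a \<le> card U * exp (- (4 * C * R))"
  proof -
    \<comment> \<open>From \<open>1 + R + R^2 / 2 \<le> exp R\<close> and
      \<open>(R - 1)^2 \<ge> 0\<close>.\<close>
    have "2 * R \<le> exp R"
      using exp_lower_Taylor_quadratic[of R] R zero_le_power2[of "R - 1"]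
      by (simp add: power2_eq_square algebra_simps)
    then have "2 * exp (- R) \<le> 1 / R" using R by (simp add: exp_minus field_simps)
    have "2 * a = n * exp (- (4 * C * R)) * (2 * exp (- R))"
      by (simp add: a_def exp_minus exp_add algebra_simps divide_simps)
    also have "\<dots> \<le> n * exp (- (4 * C * R)) * (1 / R)"
      using \<open>2 * exp (- R) \<le> 1 / R\<close> n by (intro mult_left_mono) auto
    also have "\<dots> = (n / R) * exp (- (4 * C * R))" by simp
    also have "\<dots> \<le> card U * exp (- (4 * C * R))" using U(2) by (intro mult_right_mono) auto
    finally show ?thesis .
  qed
  ultimately have M: "2 * a \<le> ?M" by linarith
  have "measure_pmf.prob ?p {as. ?N as < a} \<le> measure_pmf.prob ?p {as. (?N as - ?M)\<^sup>2 \<ge> a\<^sup>2}"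
  proof (rule measure_pmf.finite_measure_mono)
    show "{as. ?N as < a} \<subseteq> {as. (?N as - ?M)\<^sup>2 \<ge> a\<^sup>2}"
    proof clarsimp
      fix as assume "?N as < a"
      then have "a\<^sup>2 \<le> (?M - ?N as)\<^sup>2" using M a by (intro power_mono) auto
      then show "a\<^sup>2 \<le> (?N as - ?M)\<^sup>2" by (simp only: power2_commute)
    qed
  qed simp
  also have "\<dots> \<le> measure_pmf.expectation ?p (\<lambda>as. (?N as - ?M)\<^sup>2) / a\<^sup>2"
    using integral_Markov_inequality_measure[of "measure_pmf ?p" "\<lambda>as. (?N as - ?M)\<^sup>2" "UNIV" "a\<^sup>2"] a
    by (simp add: integrable_measure_pmf_finite)
  also have "\<dots> \<le> 4 * \<gamma> * length qs / a\<^sup>2"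
    using variance_remaining[OF U(1), of \<gamma>] \<gamma> by (intro divide_right_mono) auto
  also have "\<dots> \<le> 4 * (C * n) / a\<^sup>2" using len' by (intro divide_right_mono) auto
  also have "\<dots> = 4 * C * (exp ((4 * C + 1) * R))\<^sup>2 / n"
    using n by (simp add: a_def power2_eq_square field_simps)
  finally show ?thesis unfolding a_def .
qed

section \<open>Iteration over the rounds\<close>

text \<open>After \<open>k\<close> rounds at least \<open>n / decay C k\<close> elements are untouched with high probability.\<close>

fun decay :: "real \<Rightarrow> nat \<Rightarrow> real" where
  "decay C 0 = 1"
| "decay C (Suc k) = exp ((4 * C + 1) * decay C k)"

text \<open>The bound by \<open>k\<close> later absorbs the number of rounds into a power of
  \<open>decay\<close>.\<close>

lemma decay_ge: "C > 0 \<Longrightarrow> decay C k \<ge> 1 \<and> decay C k \<ge> k"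
proof (induction k)
  case (Suc k)
  then have "0 \<le> 4 * C * decay C k" by simp
  then have "decay C k \<le> (4 * C + 1) * decay C k" by (simp add: algebra_simps)
  moreover have "1 + (4 * C + 1) * decay C k \<le> decay C (Suc k)"
    unfolding decay.simps by (rule exp_ge_add_one_self)
  moreover have "1 \<le> decay C k" "k \<le> decay C k" using Suc by auto
  ultimately show ?case unfolding of_nat_Suc by (intro conjI; linarith)
qed simp

lemma decay_mono: "C > 0 \<Longrightarrow> k \<le> m \<Longrightarrow> decay C k \<le> decay C m"
proof (rule lift_Suc_mono_le[of "decay C"])
  fix k assume C: "C > 0"
  have "0 \<le> 4 * C * decay C k" using C decay_ge[OF C, of k] by simp
  then have "decay C k \<le> (4 * C + 1) * decay C k" by (simp add: algebra_simps)
  moreover have "1 + (4 * C + 1) * decay C k \<le> decay C (Suc k)"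
    unfolding decay.simps by (rule exp_ge_add_one_self)
  ultimately show "decay C k \<le> decay C (Suc k)" by linarith
qed

definition bounded_run :: "real \<Rightarrow> (nat \<Rightarrow> nat) \<Rightarrow> algorithm \<Rightarrow> nat \<Rightarrow> real \<Rightarrow> bool" where
  "bounded_run \<gamma> \<sigma> t T B \<longleftrightarrow>
     (\<forall>(bs, x) \<in> set_pmf (run \<gamma> \<sigma> t). length bs \<le> T \<and> (\<forall>qs \<in> set bs. real (length qs) \<le> B))"

lemma bounded_run_Round:
  assumes "bounded_run \<gamma> \<sigma> (Round qs f) T B"
  obtains T' where "T = Suc T'" "real (length qs) \<le> B"
    "\<And>as. as \<in> set_pmf (erasure_answers \<gamma> \<sigma> qs) \<Longrightarrow> bounded_run \<gamma> \<sigma> (f as) T' B"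
proof -
  have *: "length bs < T \<and> real (length qs) \<le> B \<and> (\<forall>qs \<in> set bs. real (length qs) \<le> B)"
    if "as \<in> set_pmf (erasure_answers \<gamma> \<sigma> qs)" "(bs, x) \<in> set_pmf (run \<gamma> \<sigma> (f as))" for as bs x
  proof -
    have "(qs # bs, x) \<in> set_pmf (run \<gamma> \<sigma> (Round qs f))" using that by force
    then show ?thesis using assms by (fastforce simp: bounded_run_def)
  qed
  \<comment> \<open>Supports are nonempty, so some complete run exists; it witnesses
    \<open>T > 0\<close> and the bound on the batch \<open>qs\<close>.\<close>
  obtain as where as: "as \<in> set_pmf (erasure_answers \<gamma> \<sigma> qs)"
    using set_pmf_not_empty[of "erasure_answers \<gamma> \<sigma> qs"] by blast
  obtain y where "y \<in> set_pmf (run \<gamma> \<sigma> (f as))"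
    using set_pmf_not_empty[of "run \<gamma> \<sigma> (f as)"] by blast
  then obtain bs x where "(bs, x) \<in> set_pmf (run \<gamma> \<sigma> (f as))" by (cases y) auto
  from *[OF as this] have "T > 0" "real (length qs) \<le> B" by auto
  then obtain T' where T': "T = Suc T'" by (cases T) auto
  show ?thesis
    by (rule that[OF T' \<open>real (length qs) \<le> B\<close>])
       (use * T' in \<open>fastforce simp: bounded_run_def\<close>)
qed

text \<open>A union bound over the \<open>d\<close> rounds still allowed after \<open>k\<close>
  rounds. The same failure probability serves for every round, because \<open>decay C T\<close>
  dominates all earlier values.\<close>

lemma prob_none_remaining_le:
  assumes \<gamma>: "0 < \<gamma>" "\<gamma> \<le> 1 / 2" and C: "C > 0" and n: "n > (0 :: real)"
    and "bounded_run \<gamma> \<sigma> t d (C * (n / \<gamma>))" "k + d = T" "finite U" "real (card U) \<ge> n / decay C k"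
  shows "measure_pmf.prob (tracked_run \<gamma> \<sigma> t U) {(V, x). V = {}} \<le> d * (4 * C * (decay C T)\<^sup>2 / n)"
  using assms(5-)
proof (induction t arbitrary: d k U)
  case (Output y)
  have "U \<noteq> {}"
  proof
    assume "U = {}"
    then have "n / decay C k \<le> 0" using Output by simp
    then show False using n decay_ge[OF C, of k] by (simp add: divide_le_0_iff)
  qed
  then show ?case using C n by simp
next
  case (Round qs f)
  let ?\<epsilon> = "4 * C * (decay C T)\<^sup>2 / n"
  let ?p = "erasure_answers \<gamma> \<sigma> qs"
  let ?S = "{as. real (card (remaining qs as U)) < n / decay C (Suc k)}"
  let ?q = "\<lambda>as. measure_pmf.prob (tracked_run \<gamma> \<sigma> (f as) (remaining qs as U)) {(V, x). V = {}}"
  obtain d' where d': "d = Suc d'" and len: "real (length qs) \<le> C * (n / \<gamma>)"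
    and bd: "\<And>as. as \<in> set_pmf ?p \<Longrightarrow> bounded_run \<gamma> \<sigma> (f as) d' (C * (n / \<gamma>))"
    using bounded_run_Round[OF Round.prems(1)] by blast
  have "measure_pmf.prob ?p ?S \<le> 4 * C * (decay C (Suc k))\<^sup>2 / n"
    using prob_remaining_small[OF Round.prems(3,4) \<gamma> C n _ len] decay_ge[OF C, of k] by simp
  also have "\<dots> \<le> ?\<epsilon>"
    using decay_mono[OF C, of "Suc k" T] Round.prems(2) d' C n decay_ge[OF C, of "Suc k"]
    by (intro divide_right_mono mult_left_mono power_mono) auto
  finally have S: "measure_pmf.prob ?p ?S \<le> ?\<epsilon>" .
  have \<epsilon>: "0 \<le> ?\<epsilon>" using C n by simp
  \<comment> \<open>Either the batch leaves too few elements, which the indicator pays for, or the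
    induction hypothesis applies with \<open>Suc k\<close>.\<close>
  have q: "?q as \<le> indicator ?S as + d' * ?\<epsilon>" if "as \<in> set_pmf ?p" for as
  proof (cases "as \<in> ?S")
    case True
    then have "1 \<le> indicator ?S as + d' * ?\<epsilon>" using mult_nonneg_nonneg[OF of_nat_0_le_iff \<epsilon>] by simp
    then show ?thesis using measure_pmf.prob_le_1 by (rule order_trans[rotated])
  next
    case False
    have "?q as \<le> d' * ?\<epsilon>"
      by (rule Round.IH[OF rangeI bd[OF that], of "Suc k"])
         (use False Round.prems d' finite_subset[OF remaining_subset] in auto)
    then show ?thesis using False by simp
  qed
  have int: "integrable (measure_pmf ?p) g" for g :: "answer list \<Rightarrow> real"
    by (rule integrable_measure_pmf_finite) simp
  have "measure_pmf.prob (tracked_run \<gamma> \<sigma> (Round qs f) U) {(V, x). V = {}} = measure_pmf.expectation ?p ?q"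
    by (simp add: prob_bind_pmf)
  also have "\<dots> \<le> measure_pmf.expectation ?p (\<lambda>as. indicator ?S as + d' * ?\<epsilon>)"
    using q by (intro integral_mono_AE int) (auto simp: AE_measure_pmf_iff)
  also have "\<dots> = measure_pmf.prob ?p ?S + d' * ?\<epsilon>"
    by (simp add: Bochner_Integration.integral_add[OF int int] del: Bochner_Integration.integral_add)
  also have "\<dots> \<le> d * ?\<epsilon>" using S by (simp only: d' of_nat_Suc distrib_right mult_1)
  finally show ?case .
qed

text \<open>If \<epsilon> bounds the probability that no element stays untouched, success has
  probability at most \<open>(1 + \<epsilon>) / 2\<close>. This is below \<open>2 / 3\<close> when
  \<open>\<epsilon> < 1 / 3\<close>, whence 12 = 3 * 4 in the last assumption.\<close>

lemma select_success_prob_less: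
  assumes \<gamma>: "0 < \<gamma>" "\<gamma> \<le> 1 / 2" and C: "C > 0" and n: "n \<ge> 2"
    and cmp: "comparisons_per_round_le n \<gamma> A (C * (real n / \<gamma>))"
    and rc: "round_complexity n \<gamma> A \<le> enat T"
    and T: "12 * C * T * (decay C T)\<^sup>2 < n"
  shows "select_success_prob n \<gamma> A < 2 / 3"
proof -
  let ?P = "{\<sigma>. \<sigma> permutes {..<n}}"
  let ?\<epsilon> = "T * (4 * C * (decay C T)\<^sup>2 / n)"
  let ?s = "\<lambda>t \<sigma>. measure_pmf.prob (map_pmf snd (run \<gamma> \<sigma> t)) {x. is_median n \<sigma> x}"
  have P: "finite ?P" "?P \<noteq> {}" "card ?P > 0"
    using finite_permutations[of "{..<n}"] permutes_id[of "{..<n}"]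
    by (auto simp: card_gt_0_iff simp del: permutes_id)
  have bd: "bounded_run \<gamma> \<sigma> t T (C * (real n / \<gamma>))" if "t \<in> set_pmf A" "\<sigma> \<in> ?P" for t \<sigma>
    unfolding bounded_run_def
  proof (intro ballI, clarify, intro conjI ballI)
    fix bs x assume "(bs, x) \<in> set_pmf (run \<gamma> \<sigma> t)"
    then have mem: "(\<sigma>, bs, x) \<in> set_pmf (joint_run n \<gamma> A)"
      using that P by (force simp: joint_run_def)
    have "enat (length bs) \<le> round_complexity n \<gamma> A"
      unfolding round_complexity_def using SUP_upper[OF mem, of "\<lambda>(\<sigma>, bs, x). enat (length bs)"] by simp
    then have "enat (length bs) \<le> enat T" using rc by (rule order_trans)
    then show "length bs \<le> T" by simp
    fix qs assume "qs \<in> set bs"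
    then show "real (length qs) \<le> C * (real n / \<gamma>)"
      using cmp mem by (fastforce simp: comparisons_per_round_le_def)
  qed
  have sum: "(\<Sum>\<sigma>\<in>?P. ?s t \<sigma>) / card ?P \<le> (1 + ?\<epsilon>) / 2" if "t \<in> set_pmf A" for t
  proof -
    have "(\<Sum>\<sigma>\<in>?P. ?s t \<sigma>) \<le> card ?P * ((1 + ?\<epsilon>) / 2)"
    proof (rule sum_success_le[OF n])
      fix \<sigma> assume "\<sigma> permutes {..<n}"
      then show "measure_pmf.prob (tracked_run \<gamma> \<sigma> t {..<n}) {(V, x). V = {}} \<le> ?\<epsilon>"
        using bd[OF that] n by (intro prob_none_remaining_le[OF \<gamma> C, where k = 0]) auto
    qed
    then show ?thesis using P by (simp add: field_simps)
  qed
  \<comment> \<open>The order and the algorithm are drawn independently; exchanging them leaves a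
    bound for each deterministic algorithm, averaged over all orders.\<close>
  have "joint_run n \<gamma> A = bind_pmf A (\<lambda>t. bind_pmf (pmf_of_set ?P)
      (\<lambda>\<sigma>. map_pmf (\<lambda>(bs, x). (\<sigma>, bs, x)) (run \<gamma> \<sigma> t)))"
    unfolding joint_run_def by (rule bind_commute_pmf)
  then have "select_success_prob n \<gamma> A = measure_pmf.expectation A (\<lambda>t.
      measure_pmf.prob (bind_pmf (pmf_of_set ?P) (\<lambda>\<sigma>. map_pmf (\<lambda>(bs, x). (\<sigma>, bs, x)) (run \<gamma> \<sigma> t)))
        {(\<sigma>, bs, x). is_median n \<sigma> x})"
    unfolding select_success_prob_def by (simp only: prob_bind_pmf)
  also have "\<dots> = measure_pmf.expectation A (\<lambda>t. (\<Sum>\<sigma>\<in>?P. ?s t \<sigma>) / card ?P)"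
  proof -
    have "(\<lambda>(bs :: query list list, x). (\<sigma>, bs, x)) -` {(\<sigma>, bs, x). is_median n \<sigma> x} = snd -` {x. is_median n \<sigma> x}"
      for \<sigma> :: "nat \<Rightarrow> nat" by auto
    then show ?thesis
      by (simp only: prob_bind_pmf integral_pmf_of_set[OF P(2,1)] measure_map_pmf)
  qed
  also have "\<dots> \<le> measure_pmf.expectation A (\<lambda>t. (1 + ?\<epsilon>) / 2)"
  proof (rule integral_mono_AE)
    have "(\<Sum>\<sigma>\<in>?P. ?s t \<sigma>) / card ?P \<le> 1" for t
      using P sum_mono[of ?P "?s t" "\<lambda>_. 1"] by (simp add: divide_le_eq)
    then show "integrable (measure_pmf A) (\<lambda>t. (\<Sum>\<sigma>\<in>?P. ?s t \<sigma>) / card ?P)"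
      by (intro measure_pmf.integrable_const_bound[where B = 1]) (auto simp: sum_nonneg)
  qed (use sum in \<open>auto simp: AE_measure_pmf_iff\<close>)
  also have "\<dots> = (1 + ?\<epsilon>) / 2" by simp
  also have "\<dots> < 2 / 3"
  proof -
    have "?\<epsilon> * 3 < 1" using T n by (simp add: field_simps)
    then show ?thesis by simp
  qed
  finally show ?thesis .
qed

section \<open>Towers of twos and the iterated logarithm\<close>

fun tower :: "nat \<Rightarrow> real" where
  "tower 0 = 1"
| "tower (Suc k) = 2 powr tower k"

lemma tower_ge: "tower k \<ge> k"
proof (induction k)
  case (Suc k)
  have "real (Suc k) \<le> 2 ^ k"
    using of_nat_mono[OF Suc_leI[OF less_exp[of k]], where 'a = real] by simp
  also have "\<dots> \<le> 2 powr tower k" using Suc powr_mono[of "real k" "tower k" 2] by (simp add: powr_realpow)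
  finally show ?case by simp
qed simp

lemma tower_mono: "k \<le> m \<Longrightarrow> tower k \<le> tower m"
proof (rule lift_Suc_mono_le[of tower])
  fix k show "tower k \<le> tower (Suc k)" by (induction k) auto
qed

text \<open>Peels off the innermost logarithm: as \<open>x > 1\<close>,
  \<open>tower j < log 2 x\<close> means \<open>tower (Suc j) < x\<close>.\<close>

lemma tower_less_if_log_iterates:
  "\<forall>i\<le>j. (log 2 ^^ i) x > 1 \<Longrightarrow> tower j < x"
proof (induction j arbitrary: x)
  case 0
  then show ?case by simp
next
  case (Suc j)
  have "(log 2 ^^ i) (log 2 x) > 1" if "i \<le> j" for i
    using Suc.prems[rule_format, of "Suc i"] that by (simp add: funpow_swap1)
  then have "tower j < log 2 x" by (intro Suc.IH) auto
  moreover have "x > 1" using Suc.prems[rule_format, of 0] by simp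
  ultimately show ?case by (simp add: less_log_iff)
qed

lemma tower_less_if_less_log_star: "j < log_star x \<Longrightarrow> tower j < x"
  using not_less_Least[of _ "\<lambda>k. (log 2 ^^ k) x \<le> 1"]
  by (intro tower_less_if_log_iterates) (auto simp: log_star_def not_le)

text \<open>A double exponential eventually exceeds an exponential of any fixed rate, so two tower
  levels pay for one step of \<open>decay\<close>. The offset \<open>s\<close> lifts the start to
  where these estimates hold and adds two levels for the polynomial factor.\<close>

lemma decay_less_tower:
  fixes C :: real
  assumes C: "C > 0"
  obtains s where "\<And>T. 12 * C * T * (decay C T)\<^sup>2 < tower (2 * T + s)" 
proof -
  \<comment> \<open>The cubic term anticipates \<open>T \<le> decay C T \<le> x\<close>, by which
    \<open>T * (decay C T)^2\<close> is at most \<open>x ^ 3\<close>.\<close>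
  have "eventually (\<lambda>x::real. exp ((4 * C + 1) * x) \<le> 2 powr (2 powr x) \<and> 12 * C * x ^ 3 < 2 powr (2 powr x)) at_top"
    using C by (intro eventually_conj; real_asymp)
  then obtain x0 where x0: "\<And>x. x \<ge> x0 \<Longrightarrow> exp ((4 * C + 1) * x) \<le> 2 powr (2 powr x)"
      "\<And>x. x \<ge> x0 \<Longrightarrow> 12 * C * x ^ 3 < 2 powr (2 powr x)"
    by (auto simp: eventually_at_top_linorder)
  obtain s0 where "x0 \<le> real s0" using real_arch_simple by blast
  then have s0: "x0 \<le> tower (2 * k + s0)" for k
    using tower_ge[of s0] tower_mono[of s0 "2 * k + s0"] by linarith
  have le: "decay C k \<le> tower (2 * k + s0)" for k
  proof (induction k)
    case 0
    then show ?case using tower_mono[of 0 s0] by simp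
  next
    case (Suc k)
    have "decay C (Suc k) \<le> exp ((4 * C + 1) * tower (2 * k + s0))"
      using Suc C by (simp add: mult_left_mono)
    also have "\<dots> \<le> tower (2 * Suc k + s0)" using x0(1)[OF s0[of k]] by simp
    finally show ?case .
  qed
  show ?thesis
  proof (rule that[of "s0 + 2"])
    fix T
    let ?x = "tower (2 * T + s0)"
    have "12 * C * T * (decay C T)\<^sup>2 \<le> 12 * C * ?x * ?x\<^sup>2"
      using C decay_ge[OF C, of T] le[of T] by (intro mult_mono power_mono) auto
    also have "\<dots> = 12 * C * ?x ^ 3" by (simp add: power2_eq_square power3_eq_cube)
    also have "\<dots> < tower (2 * T + (s0 + 2))" using x0(2)[OF s0[of T]] by simp
    finally show "12 * C * T * (decay C T)\<^sup>2 < tower (2 * T + (s0 + 2))" .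
  qed
qed

theorem theorem10:
  fixes C :: real
  assumes "C > 0"
  shows "\<exists>c > 0. \<forall>\<^sub>F n in sequentially. \<forall>(\<gamma>::real) (A::algorithm pmf).
           0 < \<gamma> \<longrightarrow> \<gamma> \<le> 1 / 2 \<longrightarrow>
           queries_elements n \<gamma> A \<longrightarrow>
           comparisons_per_round_le n \<gamma> A (C * (real n / \<gamma>)) \<longrightarrow>
           select_success_prob n \<gamma> A \<ge> 2 / 3 \<longrightarrow>
           ereal (c * real (log_star (real n))) \<le> ereal_of_enat (round_complexity n \<gamma> A)"
proof -
  obtain s where s: "\<And>T. 12 * C * T * (decay C T)\<^sup>2 < tower (2 * T + s)"
    using decay_less_tower[OF assms] by blast
  show ?thesis
  \<comment> \<open>The argument gives \<open>log_star n \<le> 2 * T + s\<close> for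
    \<open>T\<close> rounds, and for \<open>T \<ge> 1\<close> this is at most
    \<open>(s + 2) * T\<close>.\<close>
  proof (intro exI[of _ "1 / (real s + 2)"] conjI eventually_mono[OF eventually_ge_at_top[of 2]] allI impI)
    fix n :: nat and \<gamma> :: real and A :: "algorithm pmf"
    assume n: "2 \<le> n" and \<gamma>: "0 < \<gamma>" "\<gamma> \<le> 1 / 2"
      and cmp: "comparisons_per_round_le n \<gamma> A (C * (real n / \<gamma>))"
      and succ: "select_success_prob n \<gamma> A \<ge> 2 / 3"
    let ?l = "log_star (real n)"
    show "ereal (1 / (real s + 2) * real ?l) \<le> ereal_of_enat (round_complexity n \<gamma> A)"
    proof (cases "round_complexity n \<gamma> A")
      case (enat T)
      have "\<not> 12 * C * T * (decay C T)\<^sup>2 < n"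
        using select_success_prob_less[OF \<gamma> assms n cmp] succ enat by fastforce
      \<comment> \<open>For \<open>T = 0\<close> the left-hand side is 0, hence below
        \<open>n\<close>; \<open>2 * T + s < ?l\<close> would put it below a tower smaller than
        \<open>n\<close>.\<close>
      then have "T \<noteq> 0" and "\<not> 2 * T + s < ?l"
        using n s[of T] tower_less_if_less_log_star[of "2 * T + s" "real n"] by (cases "T = 0"; force)+
      then have "?l \<le> 2 * T + s * 1" by simp
      also have "\<dots> \<le> 2 * T + s * T" using \<open>T \<noteq> 0\<close> by (intro add_left_mono mult_left_mono) auto
      finally have "?l \<le> T * (s + 2)" by (simp add: algebra_simps)
      then have "real ?l \<le> real T * (real s + 2)" by (metis of_nat_le_iff of_nat_mult of_nat_add of_nat_numeral)
      then show ?thesis using enat by (simp add: divide_le_eq)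
    qed simp
  qed simp
qed

end
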